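(* Let $\alpha>0$ and $0<\gamma<1$. If $A\subseteq\mathbb{N}$ has positive upper asymptotic density, then $g_{\alpha,\gamma}[A]$ has positive upper asymptotic density. In other words, $g_{\alpha,\gamma}[\mathcal{PUAD}]\subseteq\mathcal{PUAD}$.
   Context: $\mathbb{N}=\{1,2,3,\dots\}$. For $\alpha>0$ and $0<\gamma<1$, $g_{\alpha,\gamma}(n)=\lfloor \alpha n+\gamma\rfloor$ for $n\in\mathbb{N}$; for $A\subseteq\mathbb{N}$, $g_{\alpha,\gamma}[A]=\{g_{\alpha,\gamma}(n):n\in A\}\cap\mathbb{N}$ (a value $0$, which can occur for finitely many $n$ when $\alpha$ is small, is discarded). The upper asymptotic density of $A\subseteq\mathbb{N}$ is $\overline{d}(A)=\limsup_{n\to\infty}\frac{|A\cap\{1,2,\dots,n\}|}{n}$, and $\mathcal{PUAD}=\{A\subseteq\mathbb{N}:\overline{d}(A)>0\}$. For a collection $\mathcal{F}$ of subsets of $\mathbb{N}$, $g_{\alpha,\gamma}[\mathcal{F}]=\{g_{\alpha,\gamma}[A]:A\in\mathcal{F}\}$. *)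

theory Defs
  imports Complex_Main "HOL-Library.Extended_Real"
begin

(* The natural numbers start at 1 here, so subsets of them are the A :: nat set with A \<subseteq> pos_nats. *)
definition pos_nats :: "nat set" where
  "pos_nats = {1..}"

definition g :: "real \<Rightarrow> real \<Rightarrow> nat \<Rightarrow> int" where
  "g \<alpha> \<gamma> n = \<lfloor>\<alpha> * real n + \<gamma>\<rfloor>"

(* Image of A intersected with the positive naturals: a value 0 is discarded. *)
definition g_image :: "real \<Rightarrow> real \<Rightarrow> nat set \<Rightarrow> nat set" where
  "g_image \<alpha> \<gamma> A = {m \<in> pos_nats. int m \<in> g \<alpha> \<gamma> ` A}"

definition g_family :: "real \<Rightarrow> real \<Rightarrow> nat set set \<Rightarrow> nat set set" where
  "g_family \<alpha> \<gamma> \<F> = g_image \<alpha> \<gamma> ` \<F>"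

(* The limsup is taken in ereal, where it always exists; the term at n = 0 is irrelevant to it. *)
definition upper_density :: "nat set \<Rightarrow> ereal" where
  "upper_density A = limsup (\<lambda>n. ereal (real (card (A \<inter> {1..n})) / real n))"

definition PUAD :: "nat set set" where
  "PUAD = {A. A \<subseteq> pos_nats \<and> upper_density A > 0}"

end

theory Submission
  imports Defs
begin

text \<open>
  Consecutive terms of \<open>\<alpha> n + \<gamma>\<close> are \<open>\<alpha>\<close> apart, so at most \<open>K = \<lceil>1/\<alpha>\<rceil>\<close> of them have the same integer
  part. Passing from \<open>A\<close> to its image therefore shrinks counts by a factor of at most \<open>K\<close>, while
  the image of \<open>{1..n}\<close> stays below \<open>L n\<close> for a constant \<open>L\<close>. Up to one point lost to the discarded
  value \<open>0\<close>, this gives \<open>\<bar>A \<inter> {1..n}\<bar> \<le> K (\<bar>B \<inter> {1..L n}\<bar> + 1)\<close> for the image \<open>B\<close>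
  (\<open>card_le_card_g_image\<close>). If the left side is at least \<open>c n\<close> for arbitrarily large \<open>n\<close>, then
  \<open>\<bar>B \<inter> {1..L n}\<bar> \<ge> (c / (2 K L)) (L n)\<close> for arbitrarily large \<open>n\<close>, because \<open>1\<close> is negligible against
  \<open>c n / K\<close>. So \<open>B\<close> has positive upper density along the multiples of \<open>L\<close>, hence outright.
\<close>

lemma upper_density_pos_iff:
  "upper_density A > 0 \<longleftrightarrow>
     (\<exists>c>0. \<exists>\<^sub>F n in sequentially. c * real n \<le> real (card (A \<inter> {1..n})))"
proof -
  let ?d = "\<lambda>n. real (card (A \<inter> {1..n})) / real n"
  have le_iff: "c \<le> ?d n \<longleftrightarrow> c * real n \<le> real (card (A \<inter> {1..n}))" if "n > 0" for c n
    using that by (simp add: field_simps)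
  have freq_iff: "(\<exists>\<^sub>F n in sequentially. c \<le> ?d n) \<longleftrightarrow>
      (\<exists>\<^sub>F n in sequentially. c * real n \<le> real (card (A \<inter> {1..n})))" for c
    by (rule frequently_cong[OF eventually_gt_at_top[of 0] le_iff])
  have "upper_density A > 0 \<longleftrightarrow> (\<exists>y>0. \<exists>\<^sub>F n in sequentially. y \<le> ereal (?d n))"
    unfolding upper_density_def not_le[symmetric] Limsup_le_iff
    by (simp add: frequently_def not_le)
  also have "\<dots> \<longleftrightarrow> (\<exists>c>0. \<exists>\<^sub>F n in sequentially. c \<le> ?d n)"
  proof
    assume "\<exists>y>0. \<exists>\<^sub>F n in sequentially. y \<le> ereal (?d n)"
    then obtain y where y: "y > 0" "\<exists>\<^sub>F n in sequentially. y \<le> ereal (?d n)" by blast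
    obtain c where c: "0 < ereal c" "ereal c < y" using ereal_dense2[OF y(1)] by blast
    have "\<exists>\<^sub>F n in sequentially. c \<le> ?d n"
      using y(2) by (rule frequently_elim1) (use c(2) in \<open>metis ereal_less_eq(3) less_imp_le order_trans\<close>)
    with c(1) show "\<exists>c>0. \<exists>\<^sub>F n in sequentially. c \<le> ?d n" by auto
  next
    assume "\<exists>c>0. \<exists>\<^sub>F n in sequentially. c \<le> ?d n"
    then obtain c where "c > 0" "\<exists>\<^sub>F n in sequentially. c \<le> ?d n" by blast
    then show "\<exists>y>0. \<exists>\<^sub>F n in sequentially. y \<le> ereal (?d n)"
      by (intro exI[of _ "ereal c"]) simp
  qed
  finally show ?thesis by (simp only: freq_iff)
qed

text \<open>Two elements of one fibre of \<open>g\<close> differ by less than \<open>1/\<alpha>\<close>, so the residue modulo any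
  \<open>K \<ge> 1/\<alpha>\<close> tells the elements of a fibre apart.\<close>

lemma inj_g_mod:
  assumes "\<alpha> > 0" and "1 / \<alpha> \<le> real K"
  shows "inj (\<lambda>n. (g \<alpha> \<gamma> n, n mod K))"
proof -
  have eq: "m = n" if "g \<alpha> \<gamma> m = g \<alpha> \<gamma> n" "m mod K = n mod K" "m \<le> n" for m n
  proof -
    have "\<alpha> * (real n - real m) < 1"
      using that(1) unfolding g_def right_diff_distrib by linarith
    then have "real n - real m < 1 / \<alpha>" using assms(1) by (simp add: field_simps)
    then have "n - m < K" using assms(2) that(3) by linarith
    moreover have "K dvd n - m" using that(2,3) by (simp add: mod_eq_dvd_iff_nat[symmetric])
    ultimately show "m = n" using that(3) by (auto dest: nat_dvd_not_less[rotated])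
  qed
  show ?thesis by (rule injI) (metis eq nat_le_linear prod.inject)
qed

lemma card_le_card_image_g:
  assumes "\<alpha> > 0" and "1 / \<alpha> \<le> real K" and "finite S"
  shows "card S \<le> K * card (g \<alpha> \<gamma> ` S)"
proof -
  have "0 < 1 / \<alpha>" using assms(1) by simp
  then have "K > 0" using assms(2) by linarith
  then have "(\<lambda>n. (g \<alpha> \<gamma> n, n mod K)) ` S \<subseteq> g \<alpha> \<gamma> ` S \<times> {..<K}" by auto
  then have "card S \<le> card (g \<alpha> \<gamma> ` S \<times> {..<K})"
    using assms(3) inj_on_subset[OF inj_g_mod[OF assms(1,2)] subset_UNIV]
    by (intro card_inj_on_le) auto
  then show ?thesis by (simp add: card_cartesian_product mult.commute)
qed

text \<open>The summand \<open>1\<close> accounts for the discarded value \<open>0\<close>; the choice of \<open>L\<close> guarantees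
  \<open>\<alpha> i + \<gamma> \<le> L n\<close> whenever \<open>1 \<le> i \<le> n\<close>.\<close>

lemma card_le_card_g_image:
  assumes "\<alpha> > 0" "0 \<le> \<gamma>" "1 / \<alpha> \<le> real K" "\<alpha> + \<gamma> \<le> real L"
  shows "card (A \<inter> {1..n}) \<le> K * (card (g_image \<alpha> \<gamma> A \<inter> {1..L * n}) + 1)"
proof -
  let ?T = "insert 0 (g_image \<alpha> \<gamma> A \<inter> {1..L * n})"
  have "g \<alpha> \<gamma> ` (A \<inter> {1..n}) \<subseteq> int ` ?T"
  proof (rule image_subsetI)
    fix i assume i: "i \<in> A \<inter> {1..n}"
    have "\<gamma> \<le> \<gamma> * real i" using i assms(2) by (intro mult_le_cancel_left1[THEN iffD2]) auto
    then have "\<alpha> * real i + \<gamma> \<le> (\<alpha> + \<gamma>) * real i" by (simp add: algebra_simps)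
    also have "\<dots> \<le> real L * real n" using i assms by (intro mult_mono) auto
    finally have "g \<alpha> \<gamma> i \<le> int (L * n)" unfolding g_def by (simp add: floor_le_iff)
    moreover have "0 \<le> g \<alpha> \<gamma> i" using assms(1,2) by (simp add: g_def)
    ultimately have "nat (g \<alpha> \<gamma> i) \<in> ?T" "int (nat (g \<alpha> \<gamma> i)) = g \<alpha> \<gamma> i"
      using i by (auto simp: g_image_def pos_nats_def nat_le_iff)
    then show "g \<alpha> \<gamma> i \<in> int ` ?T" by (metis imageI)
  qed
  then have "card (g \<alpha> \<gamma> ` (A \<inter> {1..n})) \<le> card ?T"
    by (meson card_image_le card_mono finite.insertI finite_Int finite_atLeastAtMost
        finite_imageI le_trans)
  also have "\<dots> \<le> card (g_image \<alpha> \<gamma> A \<inter> {1..L * n}) + 1"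
    by (metis Suc_eq_plus1 card_insert_le_m1 card_insert_if finite_Int finite_atLeastAtMost le_Suc_eq order_refl)
  finally show ?thesis
    using card_le_card_image_g[OF assms(1,3), of "A \<inter> {1..n}" \<gamma>]
    by (meson finite_Int finite_atLeastAtMost le_trans mult_le_mono2)
qed

lemma upper_density_g_image_pos:
  assumes "\<alpha> > 0" "0 \<le> \<gamma>" "upper_density A > 0"
  shows "upper_density (g_image \<alpha> \<gamma> A) > 0"
proof -
  let ?B = "g_image \<alpha> \<gamma> A"
  obtain c where c: "c > 0" "\<exists>\<^sub>F n in sequentially. c * real n \<le> real (card (A \<inter> {1..n}))"
    using assms(3) upper_density_pos_iff by blast
  obtain K where K: "1 / \<alpha> \<le> real K" using real_arch_simple by blast
  obtain L where L: "\<alpha> + \<gamma> \<le> real L" using real_arch_simple by blast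
  have "0 < 1 / \<alpha>" using assms(1) by simp
  then have K0: "real K > 0" using K by linarith
  have L0: "real L > 0" using L assms by linarith
  define e where "e = c / (2 * real K * real L)"
  have e0: "e > 0" using c K0 L0 by (simp add: e_def)
  \<comment> \<open>Once \<open>n \<ge> 2 K / c\<close>, the lost point costs at most half of \<open>c n / K\<close>; hence the factor 2 in \<open>e\<close>.\<close>
  have "\<forall>\<^sub>F n in sequentially. 2 * real K / c \<le> real n"
    using filterlim_real_sequentially unfolding filterlim_at_top by blast
  with c(2) have "\<exists>\<^sub>F n in sequentially. c * real n \<le> real (card (A \<inter> {1..n})) \<and> 2 * real K / c \<le> real n"
    by (rule frequently_eventually_frequently)
  then have "\<exists>\<^sub>F n in sequentially. e * real (L * n) \<le> real (card (?B \<inter> {1..L * n}))"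
  proof (rule frequently_elim1)
    fix n assume n: "c * real n \<le> real (card (A \<inter> {1..n})) \<and> 2 * real K / c \<le> real n"
    have "real (card (A \<inter> {1..n})) \<le> real (K * (card (?B \<inter> {1..L * n}) + 1))"
      using card_le_card_g_image[OF assms(1,2) K L] by (simp only: of_nat_le_iff)
    then have "c * real n \<le> real K * (real (card (?B \<inter> {1..L * n})) + 1)"
      using n by (simp add: algebra_simps)
    moreover have "2 * real K \<le> c * real n" using n c(1) by (simp add: field_simps)
    ultimately have "c * real n \<le> 2 * real K * real (card (?B \<inter> {1..L * n}))"
      by (simp add: algebra_simps)
    then show "e * real (L * n) \<le> real (card (?B \<inter> {1..L * n}))"
      using K0 L0 by (simp add: e_def field_simps)
  qed
  moreover have "filterlim (\<lambda>n. L * n) sequentially sequentially"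
    using L0 by (intro filterlim_subseq strict_monoI) simp
  ultimately have "\<exists>\<^sub>F m in sequentially. e * real m \<le> real (card (?B \<inter> {1..m}))"
    unfolding frequently_def using eventually_compose_filterlim by blast
  with e0 show ?thesis using upper_density_pos_iff by blast
qed

theorem theorem2p4:
  fixes \<alpha> \<gamma> :: real
  assumes "\<alpha> > 0" and "0 < \<gamma>" and "\<gamma> < 1"
  shows "(\<forall>A. A \<subseteq> pos_nats \<longrightarrow> upper_density A > 0 \<longrightarrow> upper_density (g_image \<alpha> \<gamma> A) > 0)
    \<and> g_family \<alpha> \<gamma> PUAD \<subseteq> PUAD"
proof -
  have pos: "upper_density (g_image \<alpha> \<gamma> A) > 0" if "upper_density A > 0" for A
    using upper_density_g_image_pos assms(1,2) that by simp
  moreover have "g_image \<alpha> \<gamma> A \<subseteq> pos_nats" for A by (auto simp: g_image_def)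
  ultimately show ?thesis by (auto simp: g_family_def PUAD_def)
qed

end
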